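(* Let $N\geq 2$ and let $\alpha\in\mathbb{N}^N$ be a multi-index with $\alpha\neq 0$. Let $\varphi\colon\mathbb{R}_+\to\mathbb{R}_+$ be a function such that, for every $p\geq 0$, $\varphi(r)/r^p\to\infty$ as $r\to\infty$. Then there exists a harmonic function $h\in\mathcal{H}(\mathbb{R}^N)$, distributionally irregular for the differentiation operator $D^\alpha\colon\mathcal{H}(\mathbb{R}^N)\to\mathcal{H}(\mathbb{R}^N)$, such that $$M_\infty(h,r)\leq\varphi(r)e^{c_N r}$$ for all $r>0$ sufficiently large, where $c_2=1$ and, for $N\geq 3$, $$c_N=N\left(\prod_{j=1}^{N-1}\frac{(2j)^{2j}}{(2j+1)^{2j+1}}\right)^{1/2N}.$$
   Context: $\mathcal{H}(\mathbb{R}^N)$ is the space of real-valued harmonic functions on $\mathbb{R}^N$ with the topology of local uniform convergence, given by the increasing sequence of seminorms $\|h\|_n=\sup_{\|x\|=n}|h(x)|$, $n\in\mathbb{N}$ ($n \ge 1$); it is a Fréchet space. For a multi-index $\alpha=(\alpha_1,\dots,\alpha_N)$ of nonnegative integers (this is what $\alpha\in\mathbb{N}^N$ means here), $|\alpha|=\alpha_1+\cdots+\alpha_N$ and $D^\alpha=\frac{\partial^{|\alpha|}}{\partial x_1^{\alpha_1}\cdots\partial x_N^{\alpha_N}}$. For $r>0$, $M_\infty(h,r)=\sup_{\|x\|=r}|h(x)|$, with $\|\cdot\|$ the Euclidean norm. The exponent $1/2N$ in $c_N$ means $1/(2N)$. The upper density of $A\subset\mathbb{N}$ is $\overline{\mathrm{dens}}(A)=\limsup_{n\to\infty}\frac{|A\cap\{1,\dots,n\}|}{n}$.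 Let $X$ be a Fréchet space whose topology is given by an increasing sequence of seminorms $(\|\cdot\|_k)_{k\in\mathbb{N}}$ and $T\colon X\to X$ a continuous linear operator. A vector $x\in X$ is distributionally irregular for $T$ if both: (1) there is $A\subset\mathbb{N}$ with $\overline{\mathrm{dens}}(A)=1$ such that $T^n x\to 0$ as $n\to\infty$ with $n\in A$; and (2) there are $m\in\mathbb{N}$ and $B\subset\mathbb{N}$ with $\overline{\mathrm{dens}}(B)=1$ such that $\|T^n x\|_m\to\infty$ as $n\to\infty$ with $n\in B$. *)

theory Defs
  imports "HOL-Analysis.Analysis" "HOL-Library.Function_Algebras"
begin

definition partial_deriv :: "'n \<Rightarrow> (real ^ 'n \<Rightarrow> real) \<Rightarrow> real ^ 'n \<Rightarrow> real"
  where "partial_deriv i f x = deriv (\<lambda>t. f (x + t *\<^sub>R axis i 1)) 0"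

definition C1_fun :: "(real ^ 'n \<Rightarrow> real) \<Rightarrow> bool"
  where "C1_fun f \<longleftrightarrow>
    (\<forall>i. (\<forall>x. (\<lambda>t. f (x + t *\<^sub>R axis i 1)) field_differentiable (at 0)) \<and>
         continuous_on UNIV (partial_deriv i f))"

definition C2_fun :: "(real ^ 'n \<Rightarrow> real) \<Rightarrow> bool"
  where "C2_fun f \<longleftrightarrow> C1_fun f \<and> (\<forall>i. C1_fun (partial_deriv i f))"

definition laplacian :: "(real ^ 'n \<Rightarrow> real) \<Rightarrow> real ^ 'n \<Rightarrow> real"
  where "laplacian f x = (\<Sum>i\<in>UNIV. partial_deriv i (partial_deriv i f) x)"

definition harmonic_space :: "(real ^ 'n \<Rightarrow> real) set"
  where "harmonic_space = {h. C2_fun h \<and> (\<forall>x. laplacian h x = 0)}"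

text \<open>
  The coordinates are numbered by a linear order on the index type, and the partial derivatives
  are composed in that order, the last coordinate acting first. On smooth functions the order
  is immaterial.
\<close>

definition multi_deriv ::
    "nat ^ 'n::{finite,linorder} \<Rightarrow>
      (real ^ 'n::{finite,linorder} \<Rightarrow> real) \<Rightarrow> real ^ 'n::{finite,linorder} \<Rightarrow> real"
  where "multi_deriv \<alpha> = foldr (\<lambda>i. partial_deriv i ^^ (\<alpha> $ i)) (sorted_list_of_set UNIV)"

definition M_infty :: "(real ^ 'n \<Rightarrow> real) \<Rightarrow> real \<Rightarrow> real"
  where "M_infty h r = (SUP x\<in>sphere 0 r. \<bar>h x\<bar>)"

definition harmonic_seminorm :: "nat \<Rightarrow> (real ^ 'n \<Rightarrow> real) \<Rightarrow> real"
  where "harmonic_seminorm n h = M_infty h (real n)"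

text \<open>
  Sequences of seminorms are indexed by the positive integers; the value at index 0 is ignored.
  The vector space is given as a carrier set \<open>X\<close>, and \<open>seminorm_topology X p\<close> is the topology on
  \<open>X\<close> for which the seminorm balls form a subbase.
\<close>

definition seminorm_topology ::
    "'x::ab_group_add set \<Rightarrow> (nat \<Rightarrow> 'x \<Rightarrow> real) \<Rightarrow> 'x topology"
  where "seminorm_topology X p =
    topology_generated_by {{y \<in> X. p k (y - x) < e} |k x e. 1 \<le> k \<and> x \<in> X \<and> 0 < e}"

definition upper_density :: "nat set \<Rightarrow> ereal"
  where "upper_density A = limsup (\<lambda>n. ereal (real (card (A \<inter> {1..n})) / real n))"

text \<open>
  The filter \<open>inf sequentially (principal A)\<close> expresses that \<open>n\<close> tends to infinity within \<open>A\<close>.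
\<close>

definition distributionally_irregular ::
    "'x::ab_group_add set \<Rightarrow> (nat \<Rightarrow> 'x \<Rightarrow> real) \<Rightarrow> ('x \<Rightarrow> 'x) \<Rightarrow> 'x \<Rightarrow> bool"
  where "distributionally_irregular X p T x \<longleftrightarrow>
    x \<in> X \<and>
    (\<exists>A. upper_density A = 1 \<and>
         limitin (seminorm_topology X p) (\<lambda>n. (T ^^ n) x) 0 (inf sequentially (principal A))) \<and>
    (\<exists>m\<ge>1. \<exists>B. upper_density B = 1 \<and>
         filterlim (\<lambda>n. p m ((T ^^ n) x)) at_top (inf sequentially (principal B)))"

definition growth_const :: "nat \<Rightarrow> real"
  where "growth_const N =
    (if N = 2 then 1
     else real N *
       (\<Prod>j = 1..N - 1. real (2 * j) ^ (2 * j) / real (2 * j + 1) ^ (2 * j + 1))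
         powr (1 / (2 * real N)))"

end

theory Submission
  imports Defs
begin

text \<open>
  Take \<open>\<zeta>\<close> in the complex unit torus with \<open>\<Sum> \<zeta>\<^sub>i\<^sup>2 = 0\<close> and \<open>\<Prod> \<zeta>\<^sub>i ^ \<alpha>\<^sub>i = 1\<close>.
  For entire \<open>F\<close> the function \<open>Re (F (\<zeta> \<bullet> x))\<close> is harmonic, and \<open>D\<^sup>\<alpha>\<close> acts on it by
  differentiating \<open>F\<close> \<open>\<bar>\<alpha>\<bar>\<close> times. Since the real and imaginary parts of \<open>\<zeta>\<close> are orthogonal of
  norm \<open>sqrt (N / 2)\<close>, one has \<open>\<bar>\<zeta> \<bullet> x\<bar> \<le> sqrt (N / 2) * norm x\<close>, and convexity of \<open>t * ln t\<close>
  gives \<open>sqrt (N / 2) \<le> c\<^sub>N\<close>. It remains to choose \<open>F z = \<Sum> b\<^sub>j * z ^ j / j!\<close>, where \<open>b\<^sub>j\<close> is \<open>j\<close>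
  or \<open>0\<close> on alternating blocks \<open>i! \<le> j < (i + 1)!\<close>: then \<open>F\<close> grows at most like \<open>r * exp r\<close>,
  its derivatives are small for orders well inside a zero block and at least the order itself on
  the positive real axis for orders in the other blocks.
\<close>

section \<open>The seminorm topology of the harmonic functions\<close>

text \<open>Induction over the generated topology leaves only the subbasic balls. A ball around
  \<open>x\<close> that contains \<open>0\<close> has slack \<open>e - p k (0 - x)\<close>, and the
  triangle inequality keeps \<open>f n\<close> inside once \<open>p k (f n)\<close> is below this
  slack.\<close>

lemma limitin_seminorm_topology_zero:
  fixes p :: "nat \<Rightarrow> 'x::ab_group_add \<Rightarrow> real"
  assumes zero: "0 \<in> X" "\<And>k. k \<ge> 1 \<Longrightarrow> p k 0 = 0"
    and triangle: "\<And>k x y. \<lbrakk>k \<ge> 1; x \<in> X; y \<in> X\<rbrakk> \<Longrightarrow> p k (y - x) \<le> p k y + p k (0 - x)"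
    and f: "\<And>n. f n \<in> X"
    and lim: "\<And>k. k \<ge> 1 \<Longrightarrow> ((\<lambda>n. p k (f n)) \<longlongrightarrow> 0) F"
  shows "limitin (seminorm_topology X p) f 0 F"
proof -
  let ?B = "{{y \<in> X. p k (y - x) < e} |k x e. 1 \<le> k \<and> x \<in> X \<and> 0 < e}"
  have ev: "0 \<in> U \<longrightarrow> eventually (\<lambda>n. f n \<in> U) F" if "generate_topology_on ?B U" for U
    using that
  proof induction
    case Empty
    then show ?case by simp
  next
    case (Int a b)
    then show ?case by (auto intro: eventually_conj)
  next
    case (UN K)
    show ?case
    proof
      assume "0 \<in> \<Union>K"
      then obtain u where u: "u \<in> K" "0 \<in> u" by blast
      with UN have "eventually (\<lambda>n. f n \<in> u) F" by blast
      then show "eventually (\<lambda>n. f n \<in> \<Union>K) F"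
        by eventually_elim (use u in blast)
    qed
  next
    case (Basis s)
    then obtain k x e where s: "s = {y \<in> X. p k (y - x) < e}" "1 \<le> k" "x \<in> X" "0 < e"
      by blast
    show ?case
    proof
      assume "0 \<in> s"
      then have "0 < e - p k (0 - x)" using s by simp
      then have "eventually (\<lambda>n. p k (f n) < e - p k (0 - x)) F"
        using lim[OF s(2)] order_tendstoD(2) by blast
      then show "eventually (\<lambda>n. f n \<in> s) F"
      proof eventually_elim
        case (elim n)
        then show ?case using triangle[OF s(2,3) f[of n]] f[of n] s(1) by simp
      qed
    qed
  qed
  have "{y \<in> X. p 1 (y - 0) < 1} \<in> ?B"
    using zero(1) zero_less_one order_refl by blast
  moreover have "0 \<in> {y \<in> X. p 1 (y - 0) < 1}" using zero by simp
  ultimately have "0 \<in> topspace (seminorm_topology X p)"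
    unfolding seminorm_topology_def topology_generated_by_topspace by blast
  then show ?thesis
    unfolding limitin_def seminorm_topology_def openin_topology_generated_by_iff
    using ev by blast
qed

text \<open>
  \<open>C1_fun\<close> only provides continuous partial derivatives, whereas boundedness on spheres, and with
  it the triangle inequality for suprema, needs continuity. The coordinates are changed one at a
  time, each change being controlled by the mean value theorem.
\<close>

lemma C1_fun_isCont:
  fixes f :: "real ^ 'n \<Rightarrow> real"
  assumes "C1_fun f"
  shows "isCont f x"
proof -
  have deriv: "((\<lambda>t. f (y + t *\<^sub>R axis i 1)) has_real_derivative partial_deriv i f y) (at 0)" for i y
    using assms unfolding C1_fun_def partial_deriv_def
    by (auto intro: field_differentiable_derivI)
  have deriv': "((\<lambda>t. f (y + t *\<^sub>R axis i 1)) has_real_derivative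
      partial_deriv i f (y + s *\<^sub>R axis i 1)) (at s)" for i y s
    using DERIV_shift[of "\<lambda>t. f (y + t *\<^sub>R axis i 1)" "partial_deriv i f (y + s *\<^sub>R axis i 1)" 0 s]
      deriv[of "y + s *\<^sub>R axis i 1" i]
    by (simp add: scaleR_add_left algebra_simps)
  \<comment> \<open>\<open>S\<close> collects the coordinates in which \<open>y\<close> may differ
    from \<open>x\<close>; the case \<open>S = UNIV\<close> is continuity.\<close>
  have "\<forall>e>0. \<exists>d>0. \<forall>y. norm (y - x) < d \<and> (\<forall>i. i \<notin> S \<longrightarrow> y $ i = x $ i) \<longrightarrow> \<bar>f y - f x\<bar> < e"
    if "finite S" for S
    using that
  proof induction
    case empty
    then show ?case by (metis abs_zero diff_self empty_iff vec_eq_iff zero_less_one)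
  next
    case (insert i S)
    show ?case
    proof (intro allI impI)
      fix e :: real assume "e > 0"
      then obtain d where d: "d > 0"
        "\<And>y. \<lbrakk>norm (y - x) < d; \<And>i. i \<notin> S \<Longrightarrow> y $ i = x $ i\<rbrakk> \<Longrightarrow> \<bar>f y - f x\<bar> < e / 2"
        using insert.IH by (metis half_gt_zero)
      have "isCont (partial_deriv i f) x"
        using assms unfolding C1_fun_def by (simp add: continuous_on_eq_continuous_at)
      then obtain d' where d': "d' > 0"
        "\<And>z. norm (z - x) < d' \<Longrightarrow> \<bar>partial_deriv i f z - partial_deriv i f x\<bar> < 1"
        unfolding continuous_at_eps_delta dist_norm real_norm_def by (meson zero_less_one)
      define M where "M = \<bar>partial_deriv i f x\<bar> + 1"
      have M: "M > 0" "\<bar>partial_deriv i f z\<bar> \<le> M" if "norm (z - x) < d'" for z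
        using d'(2)[OF that] unfolding M_def by linarith+
      define \<delta> where "\<delta> = min d (min d' (e / (2 * M)))"
      have "M > 0" unfolding M_def by linarith
      have "\<bar>f y - f x\<bar> < e"
        if y: "norm (y - x) < \<delta>" "\<And>j. j \<notin> insert i S \<Longrightarrow> y $ j = x $ j" for y
      proof -
        define t where "t = y $ i - x $ i"
        \<comment> \<open>Resetting coordinate \<open>i\<close> to that of \<open>x\<close> brings
          \<open>y'\<close> under the induction hypothesis for \<open>S\<close>.\<close>
        define y' where "y' = y - t *\<^sub>R axis i 1"
        have comp: "(y' + s *\<^sub>R axis i 1 - x) $ j = (if j = i then s else y $ j - x $ j)" for s j
          unfolding y'_def t_def by (simp add: axis_def)
        have near: "norm (y' + s *\<^sub>R axis i 1 - x) \<le> norm (y - x)" if "\<bar>s\<bar> \<le> \<bar>t\<bar>" for s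
          by (rule norm_le_componentwise_cart) (use that in \<open>simp only: comp, auto simp: t_def\<close>)
        have "\<bar>f y' - f x\<bar> < e / 2"
        proof (rule d(2))
          show "norm (y' - x) < d" using near[of 0] y(1) unfolding \<delta>_def by simp
          show "y' $ j = x $ j" if "j \<notin> S" for j
            using comp[of 0 j] y(2)[of j] that by (auto split: if_splits)
        qed
        moreover have "\<bar>f y - f y'\<bar> \<le> M * \<bar>t\<bar>"
        proof -
          let ?g = "\<lambda>s. f (y' + s *\<^sub>R axis i 1)"
          have "norm (?g t - ?g 0) \<le> M * norm (t - 0)"
          proof (rule field_differentiable_bound[where S = "{- \<bar>t\<bar>..\<bar>t\<bar>}"])
            show "convex ({- \<bar>t\<bar>..\<bar>t\<bar>})" by simp
            show "(?g has_real_derivative partial_deriv i f (y' + s *\<^sub>R axis i 1))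
                (at s within {- \<bar>t\<bar>..\<bar>t\<bar>})" for s
              using deriv' by (rule has_field_derivative_at_within)
            show "norm (partial_deriv i f (y' + s *\<^sub>R axis i 1)) \<le> M" if "s \<in> {- \<bar>t\<bar>..\<bar>t\<bar>}" for s
            proof -
              have "norm (y' + s *\<^sub>R axis i 1 - x) < d'"
                using le_less_trans[OF near[of s]] that y(1) unfolding \<delta>_def by auto
              then show ?thesis using M(2) by simp
            qed
          qed auto
          then show ?thesis unfolding y'_def by simp
        qed
        moreover have "M * \<bar>t\<bar> \<le> e / 2"
        proof -
          have "\<bar>t\<bar> \<le> norm (y - x)" unfolding t_def using component_le_norm_cart[of "y - x" i] by simp
          then have "\<bar>t\<bar> \<le> e / (2 * M)" using y(1) unfolding \<delta>_def by simp
          then show ?thesis using \<open>M > 0\<close> by (simp add: field_simps)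
        qed
        ultimately show ?thesis by linarith
      qed
      moreover have "\<delta> > 0" unfolding \<delta>_def using d d' \<open>e > 0\<close> \<open>M > 0\<close> by simp
      ultimately show "\<exists>d>0. \<forall>y. norm (y - x) < d \<and> (\<forall>j. j \<notin> insert i S \<longrightarrow> y $ j = x $ j)
          \<longrightarrow> \<bar>f y - f x\<bar> < e" by blast
    qed
  qed
  from this[of UNIV] show ?thesis
    unfolding continuous_at_eps_delta dist_norm real_norm_def by simp
qed

lemma harmonic_space_continuous_on: "f \<in> harmonic_space \<Longrightarrow> continuous_on S f"
  unfolding harmonic_space_def C2_fun_def
  by (auto intro: C1_fun_isCont continuous_at_imp_continuous_on)

text \<open>A real supremum dominates its members only over a set bounded above; compactness of the
  sphere and continuity provide the bound.\<close>

lemma M_infty_ge: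
  assumes "continuous_on UNIV f" "norm x = r"
  shows "\<bar>f x\<bar> \<le> M_infty f r"
proof -
  have "compact ((\<lambda>x. \<bar>f x\<bar>) ` sphere 0 r)"
    by (intro compact_continuous_image continuous_intros continuous_on_subset[OF assms(1)]) auto
  then have "bdd_above ((\<lambda>x. \<bar>f x\<bar>) ` sphere 0 r)"
    by (intro bounded_imp_bdd_above compact_imp_bounded)
  then show ?thesis unfolding M_infty_def by (rule cSUP_upper2) (use assms in auto)
qed

lemma M_infty_le:
  assumes "r \<ge> 0" "\<And>x. norm x = r \<Longrightarrow> \<bar>f x\<bar> \<le> B"
  shows "M_infty f r \<le> B"
  unfolding M_infty_def by (rule cSUP_least) (use assms in auto)

lemma M_infty_nonneg:
  assumes "continuous_on UNIV f" "r \<ge> 0"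
  shows "M_infty f r \<ge> 0"
  using M_infty_ge[OF assms(1), of "r *\<^sub>R axis undefined 1"] assms(2) by simp

lemma M_infty_zero: "r \<ge> 0 \<Longrightarrow> M_infty 0 r = 0"
  by (intro antisym M_infty_le M_infty_nonneg) (auto simp: zero_fun_def)

lemma M_infty_diff_le:
  assumes "continuous_on UNIV f" "continuous_on UNIV g" "r \<ge> 0"
  shows "M_infty (g - f) r \<le> M_infty g r + M_infty (0 - f) r"
proof (rule M_infty_le[OF assms(3)])
  fix x :: "real ^ 'a" assume x: "norm x = r"
  have "continuous_on UNIV (0 - f)" using assms(1) by (simp add: fun_diff_def zero_fun_def continuous_on_minus)
  then show "\<bar>(g - f) x\<bar> \<le> M_infty g r + M_infty (0 - f) r"
    using M_infty_ge[OF _ x, of "0 - f"] M_infty_ge[OF assms(2) x] by simp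
qed

lemma zero_in_harmonic_space: "(0 :: real ^ 'n \<Rightarrow> real) \<in> harmonic_space"
proof -
  have pd: "partial_deriv i (0 :: real ^ 'n \<Rightarrow> real) = 0" for i
    by (rule ext) (simp add: partial_deriv_def)
  have "C1_fun (0 :: real ^ 'n \<Rightarrow> real)" unfolding C1_fun_def pd by (simp add: zero_fun_def)
  then show ?thesis unfolding harmonic_space_def C2_fun_def laplacian_def by (simp add: pd)
qed

lemma limitin_harmonic_zero:
  assumes "\<And>n. f n \<in> harmonic_space"
    and "\<And>r. r > 0 \<Longrightarrow> ((\<lambda>n. M_infty (f n) r) \<longlongrightarrow> 0) F"
  shows "limitin (seminorm_topology harmonic_space harmonic_seminorm) f 0 F"
  unfolding harmonic_seminorm_def[abs_def]
  by (rule limitin_seminorm_topology_zero)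
    (auto simp: zero_in_harmonic_space M_infty_zero assms harmonic_space_continuous_on
      simp del: diff_0 intro!: M_infty_diff_le)

section \<open>Harmonic functions of a complex linear form\<close>

text \<open>The exponential generating function of \<open>a\<close>. Dividing by the factorial turns
  differentiation into a shift of \<open>a\<close>.\<close>

definition egf :: "(nat \<Rightarrow> complex) \<Rightarrow> complex \<Rightarrow> complex"
  where "egf a z = (\<Sum>n. a n / fact n * z ^ n)"

definition egf_entire :: "(nat \<Rightarrow> complex) \<Rightarrow> bool"
  where "egf_entire a \<longleftrightarrow> (\<forall>z. summable (\<lambda>n. a n / fact n * z ^ n))"

lemma diffs_egf: "diffs (\<lambda>n. a n / fact n :: complex) = (\<lambda>n. a (Suc n) / fact n)"
  by (rule ext) (simp add: diffs_def del: of_nat_Suc)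

lemma egf_entire_Suc: "egf_entire a \<Longrightarrow> egf_entire (\<lambda>n. a (Suc n))"
  unfolding egf_entire_def using termdiff_converges_all[of "\<lambda>n. a n / fact n"]
  by (simp add: diffs_egf)

lemma egf_entire_cmult: "egf_entire a \<Longrightarrow> egf_entire (\<lambda>n. c * a n)"
  unfolding egf_entire_def using summable_mult[where c = c] by (fastforce simp: mult.assoc)

lemma egf_cmult: "egf_entire a \<Longrightarrow> egf (\<lambda>n. c * a n) z = c * egf a z"
  unfolding egf_def egf_entire_def
  using suminf_mult[where c = c and f = "\<lambda>n. a n / fact n * z ^ n"] by (simp add: mult.assoc)

lemma egf_has_field_derivative:
  "egf_entire a \<Longrightarrow> (egf a has_field_derivative egf (\<lambda>n. a (Suc n)) z) (at z)"
  unfolding egf_entire_def egf_def[abs_def]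
  using termdiffs_strong_converges_everywhere[of "\<lambda>n. a n / fact n"] by (simp add: diffs_egf)

lemma continuous_on_egf: "egf_entire a \<Longrightarrow> continuous_on S (egf a)"
  by (meson DERIV_isCont continuous_at_imp_continuous_on egf_has_field_derivative)

text \<open>Comparison with a majorant series at \<open>norm z\<close>. Geometric majorants
  \<open>B\<close> give the decay of the orbit, the linear one gives the growth bound.\<close>

lemma norm_egf_le:
  assumes "\<And>n. norm (a n) \<le> B n" "(\<lambda>n. B n / fact n * norm z ^ n) sums S"
  shows "norm (egf a z) \<le> S"
proof -
  have le: "norm (a n / fact n * z ^ n) \<le> B n / fact n * norm z ^ n" for n
    by (simp add: norm_mult norm_divide norm_power mult_right_mono divide_right_mono assms(1))
  then have "norm (egf a z) \<le> (\<Sum>n. B n / fact n * norm z ^ n)"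
    unfolding egf_def by (intro norm_suminf_le) (use assms(2) in \<open>auto simp: sums_iff\<close>)
  then show ?thesis using assms(2) by (simp add: sums_iff)
qed

lemma exp_type_sums: "(\<lambda>n. C * q ^ n / fact n * r ^ n) sums (C * exp (q * r :: real))"
  using sums_mult[OF exp_converges[of "q * r"], of C]
  by (simp add: power_mult_distrib divide_inverse mult_ac)

lemma egf_entire_exp_type:
  assumes "\<And>n. norm (a n) \<le> C * q ^ n"
  shows "egf_entire a"
  unfolding egf_entire_def
proof
  fix z :: complex
  have "summable (\<lambda>n. C * q ^ n / fact n * norm z ^ n)"
    using exp_type_sums sums_summable by blast
  then show "summable (\<lambda>n. a n / fact n * z ^ n)"
  proof (rule summable_comparison_test'[where N = 0])
    show "norm (a n / fact n * z ^ n) \<le> C * q ^ n / fact n * norm z ^ n" for n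
      by (simp add: norm_mult norm_divide norm_power mult_right_mono divide_right_mono assms)
  qed
qed

definition lin_form :: "('n \<Rightarrow> complex) \<Rightarrow> real ^ 'n \<Rightarrow> complex"
  where "lin_form \<zeta> x = (\<Sum>i\<in>UNIV. of_real (x $ i) * \<zeta> i)"

definition wave :: "('n \<Rightarrow> complex) \<Rightarrow> (nat \<Rightarrow> complex) \<Rightarrow> real ^ 'n \<Rightarrow> real"
  where "wave \<zeta> a x = Re (egf a (lin_form \<zeta> x))"

lemma lin_form_axis: "lin_form \<zeta> (x + t *\<^sub>R axis i 1) = lin_form \<zeta> x + of_real t * \<zeta> i"
proof -
  have "of_real ((x + t *\<^sub>R axis i 1) $ j) * \<zeta> j
      = of_real (x $ j) * \<zeta> j + (if j = i then of_real t * \<zeta> i else 0)" for j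
    by (simp add: axis_def algebra_simps)
  then show ?thesis unfolding lin_form_def by (simp add: sum.distrib)
qed

lemma continuous_on_lin_form: "continuous_on S (lin_form \<zeta>)"
  unfolding lin_form_def[abs_def] by (intro continuous_intros)

lemma continuous_on_wave: "egf_entire a \<Longrightarrow> continuous_on S (wave \<zeta> a)"
  unfolding wave_def[abs_def]
  by (intro continuous_intros continuous_on_compose2[OF continuous_on_egf[of a UNIV]]
      continuous_on_lin_form) auto

text \<open>Chain rule along a coordinate line. Absorbing the factor \<open>\<zeta> i\<close> into
  the coefficients makes the derivative a wave with the same \<open>\<zeta>\<close>, so the rule can
  be iterated.\<close>

lemma wave_has_partial_derivative:
  assumes "egf_entire a"
  shows "((\<lambda>t. wave \<zeta> a (x + t *\<^sub>R axis i 1)) has_real_derivative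
    wave \<zeta> (\<lambda>n. \<zeta> i * a (Suc n)) x) (at 0)"
proof -
  let ?g = "\<lambda>t::real. lin_form \<zeta> x + of_real t * \<zeta> i"
  have "(?g has_vector_derivative \<zeta> i) (at 0)"
    by (auto intro!: derivative_eq_intros)
  moreover have "(egf a has_field_derivative egf (\<lambda>n. a (Suc n)) (?g 0)) (at (?g 0))"
    using assms by (rule egf_has_field_derivative)
  ultimately have "((egf a \<circ> ?g) has_vector_derivative \<zeta> i * egf (\<lambda>n. a (Suc n)) (?g 0)) (at 0)"
    by (rule field_vector_diff_chain_at)
  then show ?thesis
    unfolding wave_def lin_form_axis egf_cmult[OF egf_entire_Suc[OF assms]]
    using has_field_derivative_Re by (fastforce simp: o_def)
qed

lemma partial_deriv_wave:
  "egf_entire a \<Longrightarrow> partial_deriv i (wave \<zeta> a) = wave \<zeta> (\<lambda>n. \<zeta> i * a (Suc n))"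
  unfolding partial_deriv_def[abs_def] by (auto intro!: DERIV_imp_deriv wave_has_partial_derivative)

lemma C1_fun_wave: "egf_entire a \<Longrightarrow> C1_fun (wave \<zeta> a)"
  unfolding C1_fun_def
  by (auto simp: partial_deriv_wave field_differentiable_def
      intro: wave_has_partial_derivative intro!: continuous_on_wave egf_entire_cmult
      egf_entire_Suc[of a])

text \<open>The Laplacian multiplies the second derivative of the entire function by the sum of the
  squares of the exponents.\<close>

lemma wave_harmonic:
  assumes "egf_entire a" "(\<Sum>i\<in>UNIV. (\<zeta> i)\<^sup>2) = 0"
  shows "wave \<zeta> a \<in> harmonic_space"
proof -
  note entire = assms(1) egf_entire_cmult egf_entire_Suc
  have "partial_deriv i (partial_deriv i (wave \<zeta> a)) x
      = Re ((\<zeta> i)\<^sup>2 * egf (\<lambda>n. a (Suc (Suc n))) (lin_form \<zeta> x))" for i x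
    unfolding partial_deriv_wave[OF assms(1)]
      partial_deriv_wave[OF egf_entire_cmult[OF egf_entire_Suc[OF assms(1)]]] wave_def
    by (simp add: egf_cmult assms(1) egf_entire_Suc[of "\<lambda>n. a (Suc n)"] egf_entire_Suc[of a]
        egf_entire_cmult power2_eq_square mult.assoc)
  then have "laplacian (wave \<zeta> a) x = 0" for x
    unfolding laplacian_def by (simp only: assms(2) flip: Re_sum sum_distrib_right) simp
  then show ?thesis
    unfolding harmonic_space_def C2_fun_def by (auto simp: partial_deriv_wave C1_fun_wave entire)
qed

lemma egf_entire_shift: "egf_entire a \<Longrightarrow> egf_entire (\<lambda>n. a (n + m))"
  by (induction m) (use egf_entire_Suc in fastforce)+

lemma partial_deriv_pow_wave:
  assumes "egf_entire a"
  shows "(partial_deriv i ^^ m) (wave \<zeta> a) = wave \<zeta> (\<lambda>n. \<zeta> i ^ m * a (n + m))"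
  by (induction m)
    (simp_all add: partial_deriv_wave egf_entire_cmult egf_entire_shift assms mult.assoc)

lemma foldr_partial_deriv_wave:
  assumes "egf_entire a"
  shows "foldr (\<lambda>i. partial_deriv i ^^ m i) is (wave \<zeta> a)
    = wave \<zeta> (\<lambda>n. (\<Prod>i\<leftarrow>is. \<zeta> i ^ m i) * a (n + (\<Sum>i\<leftarrow>is. m i)))"
  by (induction "is")
    (simp_all add: partial_deriv_pow_wave egf_entire_cmult egf_entire_shift assms mult.assoc add.assoc)

lemma multi_deriv_wave:
  assumes "egf_entire a"
  shows "multi_deriv \<alpha> (wave \<zeta> a)
    = wave \<zeta> (\<lambda>n. (\<Prod>i\<in>UNIV. \<zeta> i ^ (\<alpha> $ i)) * a (n + (\<Sum>i\<in>UNIV. \<alpha> $ i)))"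
  unfolding multi_deriv_def foldr_partial_deriv_wave[OF assms]
  by (simp add: prod.distinct_set_conv_list[symmetric] sum.distinct_set_conv_list[symmetric])

text \<open>Each application contributes the monomial in \<open>\<zeta>\<close> as a factor; when it
  is \<open>1\<close>, only a shift by the order of \<alpha> remains.\<close>

lemma multi_deriv_pow_wave:
  assumes "egf_entire a" "(\<Prod>i\<in>UNIV. \<zeta> i ^ (\<alpha> $ i)) = 1"
  shows "(multi_deriv \<alpha> ^^ n) (wave \<zeta> a) = wave \<zeta> (\<lambda>j. a (j + (\<Sum>i\<in>UNIV. \<alpha> $ i) * n))"
proof (induction n)
  case (Suc n)
  then show ?case
    by (simp add: multi_deriv_wave egf_entire_shift[OF assms(1)] assms(2) add_ac)
qed simp

section \<open>The exponents\<close>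

text \<open>A rotation \<open>w\<close> makes the value of the form real and nonnegative, hence
  equal to \<open>x \<bullet> u\<close> for the real part \<open>u\<close> of the rotated exponents.
  Cauchy-Schwarz then needs only the norm of \<open>u\<close>.\<close>

lemma norm_lin_form_le:
  fixes \<zeta> :: "'n::finite \<Rightarrow> complex"
  assumes "\<And>i. norm (\<zeta> i) = 1" "(\<Sum>i\<in>UNIV. (\<zeta> i)\<^sup>2) = 0"
  shows "norm (lin_form \<zeta> x) \<le> sqrt (CARD('n) / 2) * norm x"
proof -
  define w where "w = cis (- Arg (lin_form \<zeta> x))"
  define u :: "real ^ 'n" where "u = (\<chi> i. Re (w * \<zeta> i))"
  have "w * lin_form \<zeta> x = of_real (norm (lin_form \<zeta> x))"
    by (metis (no_types, lifting) ext cis_mult cis_zero left_minus mult.assoc mult.commute mult.left_neutral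
        rcis_cmod_Arg rcis_def w_def)
  then have "norm (lin_form \<zeta> x) = Re (w * lin_form \<zeta> x)" by simp
  also have "\<dots> = x \<bullet> u"
    unfolding lin_form_def u_def inner_vec_def
    by (simp add: sum_distrib_left mult_ac distrib_left sum_subtractf right_diff_distrib)
  also have "\<dots> \<le> norm x * norm u" by (rule norm_cauchy_schwarz)
  finally have "norm (lin_form \<zeta> x) \<le> norm x * norm u" .
  moreover have "norm u = sqrt (CARD('n) / 2)"
  proof -
    \<comment> \<open>The double angle formula; the last term cancels in the sum over
      \<open>i\<close>.\<close>
    have "(Re (w * \<zeta> i))\<^sup>2 = 1 / 2 + Re (w\<^sup>2 * (\<zeta> i)\<^sup>2) / 2" for i
    proof -
      have "(Re (w * \<zeta> i))\<^sup>2 + (Im (w * \<zeta> i))\<^sup>2 = 1"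
        using cmod_power2[of "w * \<zeta> i"] assms(1)[of i] by (simp add: norm_mult w_def)
      moreover have "Re (w\<^sup>2 * (\<zeta> i)\<^sup>2) = (Re (w * \<zeta> i))\<^sup>2 - (Im (w * \<zeta> i))\<^sup>2"
        by (metis Re_power2 power_mult_distrib)
      ultimately show ?thesis by argo
    qed
    then have "(norm u)\<^sup>2 = (\<Sum>i\<in>UNIV. 1 / 2 + Re (w\<^sup>2 * (\<zeta> i)\<^sup>2) / 2)"
      unfolding power2_norm_eq_inner inner_vec_def u_def by (simp add: power2_eq_square)
    also have "\<dots> = CARD('n) / 2 + Re (w\<^sup>2 * (\<Sum>i\<in>UNIV. (\<zeta> i)\<^sup>2)) / 2"
      unfolding sum_distrib_left Re_sum by (simp add: sum.distrib sum_divide_distrib)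
    finally show ?thesis unfolding assms(2) by (simp add: real_sqrt_unique)
  qed
  ultimately show ?thesis by (simp add: mult.commute)
qed

text \<open>The real part of \<open>\<zeta>\<close> is orthogonal to the imaginary part, so the form
  is real and nonnegative in its direction. There a power series with nonnegative coefficients has
  no cancellation.\<close>

lemma lin_form_eq_of_real:
  fixes \<zeta> :: "'n::finite \<Rightarrow> complex"
  assumes "\<And>i. norm (\<zeta> i) = 1" "(\<Sum>i\<in>UNIV. (\<zeta> i)\<^sup>2) = 0"
  obtains x \<rho> where "norm x = 1" "\<rho> \<ge> 0" "lin_form \<zeta> x = complex_of_real \<rho>"
proof -
  define u :: "real ^ 'n" where "u = (\<chi> i. Re (\<zeta> i))"
  have sums: "(\<Sum>i\<in>UNIV. (Re (\<zeta> i))\<^sup>2) - (\<Sum>i\<in>UNIV. (Im (\<zeta> i))\<^sup>2) = 0"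
    "(\<Sum>i\<in>UNIV. Re (\<zeta> i) * Im (\<zeta> i)) = 0"
    using arg_cong[OF assms(2), of Re] arg_cong[OF assms(2), of Im]
    by (simp_all add: Re_power2 Im_power2 sum_subtractf mult.assoc flip: sum_distrib_left)
  have "(\<Sum>i\<in>UNIV. (Re (\<zeta> i))\<^sup>2) + (\<Sum>i\<in>UNIV. (Im (\<zeta> i))\<^sup>2) = CARD('n)"
    using assms(1) cmod_power2[of "\<zeta> _"] by (simp flip: sum.distrib)
  with sums(1) have "(\<Sum>i\<in>UNIV. (Re (\<zeta> i))\<^sup>2) \<noteq> 0" by auto
  then have "norm u \<noteq> 0"
    unfolding norm_eq_zero by (force simp: u_def vec_eq_iff)
  moreover have "lin_form \<zeta> u = of_real (\<Sum>i\<in>UNIV. (Re (\<zeta> i))\<^sup>2)"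
    by (rule complex_eqI) (simp_all add: lin_form_def u_def power2_eq_square sums)
  moreover have "lin_form \<zeta> (c *\<^sub>R u) = of_real c * lin_form \<zeta> u" for c
    by (simp add: lin_form_def sum_distrib_left mult.assoc)
  ultimately show ?thesis
    by (intro that[of "inverse (norm u) *\<^sub>R u" "inverse (norm u) * (\<Sum>i\<in>UNIV. (Re (\<zeta> i))\<^sup>2)"])
      (simp_all add: sum_nonneg)
qed

text \<open>
  The squares of the exponents are rotated \<open>N\<close>-th roots of unity; the rotation is free and
  normalises the monomial \<open>\<zeta>\<^sup>\<alpha>\<close>, the eigenvalue of the derivative, to \<open>1\<close>.
\<close>

lemma exists_unimodular_exponents:
  fixes m :: "'n::finite \<Rightarrow> nat"
  assumes "CARD('n) \<ge> 2" "(\<Sum>i\<in>UNIV. m i) > 0"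
  obtains \<zeta> :: "'n \<Rightarrow> complex" where "\<And>i. norm (\<zeta> i) = 1" "(\<Sum>i\<in>UNIV. (\<zeta> i)\<^sup>2) = 0"
    "(\<Prod>i\<in>UNIV. \<zeta> i ^ m i) = 1"
proof -
  obtain f :: "'n \<Rightarrow> nat" where f: "bij_betw f UNIV {..<CARD('n)}"
    using ex_bij_betw_finite_nat[of "UNIV :: 'n set"] by (auto simp: lessThan_atLeast0)
  define k where "k = (\<Sum>i\<in>UNIV. m i)"
  \<comment> \<open>The phase of the monomial at the unrotated exponents, whose angles are halved
    because their squares are to be the roots of unity. Subtracting \<open>\<theta> / k\<close> from
    each angle removes it, as the monomial has degree \<open>k\<close>.\<close>
  define \<theta> where "\<theta> = (\<Sum>i\<in>UNIV. m i * (pi * f i / CARD('n)))"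
  define \<zeta> where "\<zeta> i = cis (pi * f i / CARD('n) - \<theta> / k)" for i
  define \<omega> where "\<omega> = cis (2 * pi / CARD('n))"
  have "(\<zeta> i)\<^sup>2 = cis (- 2 * \<theta> / k) * \<omega> ^ f i" for i
    unfolding \<zeta>_def \<omega>_def Complex.DeMoivre cis_mult by (rule arg_cong[of _ _ cis]) (simp add: field_simps)
  then have "(\<Sum>i\<in>UNIV. (\<zeta> i)\<^sup>2) = cis (- 2 * \<theta> / k) * (\<Sum>i\<in>UNIV. \<omega> ^ f i)"
    by (simp add: sum_distrib_left)
  also have "(\<Sum>i\<in>UNIV. \<omega> ^ f i) = (\<Sum>j<CARD('n). \<omega> ^ j)"
    by (rule sum.reindex_bij_betw[OF f])
  also have "\<dots> = 0"
  proof -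
    have "(1 - \<omega>) * (\<Sum>j<CARD('n). \<omega> ^ j) = 1 - \<omega> ^ CARD('n)"
      by (metis one_diff_power_eq)
    also have "\<omega> ^ CARD('n) = 1" unfolding \<omega>_def Complex.DeMoivre by simp
    finally have "\<omega> = 1 \<or> ?thesis" by simp
    moreover have "\<omega> \<noteq> 1"
    proof
      assume "\<omega> = 1"
      then have "cos (2 * pi / CARD('n)) = 1" unfolding \<omega>_def by (metis cis.sel(1) one_complex.sel(1))
      moreover have "cos (2 * pi / CARD('n)) < cos 0"
        by (rule cos_monotone_0_pi) (use assms(1) in \<open>auto simp: field_simps\<close>)
      ultimately show False by simp
    qed
    ultimately show ?thesis by blast
  qed
  finally have squares: "(\<Sum>i\<in>UNIV. (\<zeta> i)\<^sup>2) = 0" by simp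
  have "(\<Prod>i\<in>UNIV. \<zeta> i ^ m i) = cis (\<Sum>i\<in>UNIV. m i * (pi * f i / CARD('n) - \<theta> / k))"
    unfolding \<zeta>_def Complex.DeMoivre by (simp add: cis_conv_exp exp_sum sum_distrib_left)
  also have "(\<Sum>i\<in>UNIV. m i * (pi * f i / CARD('n) - \<theta> / k)) = \<theta> - k * (\<theta> / k)"
    unfolding \<theta>_def k_def of_nat_sum by (simp only: right_diff_distrib sum_subtractf sum_distrib_right)
  also have "\<dots> = 0" using assms(2)[folded k_def] by simp
  finally show ?thesis using squares by (intro that) (auto simp: \<zeta>_def)
qed

section \<open>The growth constant\<close>

text \<open>Equality holds for \<open>n = 1\<close>. With \<open>m = 2 * n + 1\<close> the induction
  step amounts to \<open>m ^ m \<le> (m - 1) ^ n * (m + 1) ^ (n + 1)\<close>, the midpoint convexity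
  of \<open>t * ln t\<close>, obtained here from Bernoulli's inequality.\<close>

lemma growth_const_product_ge:
  assumes "n \<ge> 1"
  shows "(\<Prod>j = 1..n - 1. real (2 * j) ^ (2 * j) / real (2 * j + 1) ^ (2 * j + 1))
    \<ge> 2 / (2 * real n) ^ n" (is "?P n \<ge> _")
  using assms
proof (induction n rule: dec_induct)
  case base
  then show ?case by simp
next
  case (step n)
  define m where "m = 2 * real n + 1"
  have even_base: "m - 1 = 2 * real n" unfolding m_def by simp
  have m: "m \<ge> 3" and n: "real n = (m - 1) / 2" using step unfolding m_def by simp_all
  have "1 \<le> (1 + real n * (- 1 / m\<^sup>2)) * (1 + 1 / m)"
    using m unfolding n by (simp add: field_simps power2_eq_square)
  also have "\<dots> \<le> (1 + (- 1 / m\<^sup>2)) ^ n * (1 + 1 / m)"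
  proof (intro mult_right_mono Bernoulli_inequality)
    have "1 \<le> m\<^sup>2" using m by (simp add: power2_eq_square mult_ge1_I)
    then show "- 1 \<le> - 1 / m\<^sup>2" by (simp add: divide_le_eq)
  qed (use m in auto)
  also have "\<dots> = ((m - 1) * (m + 1)) ^ n * (m + 1) / m ^ (2 * n + 1)"
  proof -
    have "1 + (- 1 / m\<^sup>2) = (m - 1) * (m + 1) / m\<^sup>2"
      using m by (simp add: field_simps power2_eq_square)
    then show ?thesis using m by (simp add: power_divide mult_2_right power_add power_mult[symmetric] field_simps)
  qed
  finally have one_le: "1 \<le> (m - 1) ^ n * (m + 1) ^ Suc n / m ^ (2 * n + 1)"
    by (simp add: power_mult_distrib mult_ac)
  have "2 / (m + 1) ^ Suc n * 1
      \<le> 2 / (m + 1) ^ Suc n * ((m - 1) ^ n * (m + 1) ^ Suc n / m ^ (2 * n + 1))"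
    by (rule mult_left_mono[OF one_le]) (use m in simp)
  also have "\<dots> = 2 / (m - 1) ^ n * ((m - 1) ^ (2 * n) / m ^ (2 * n + 1))"
  proof -
    \<comment> \<open>Used with \<open>p = (m - 1) ^ n\<close>, \<open>q = (m + 1) ^ Suc n\<close>
      and \<open>d = m ^ (2 * n + 1)\<close>.\<close>
    have "2 / q * (p * q / d) = 2 / p * (p * p / d)" if "p \<noteq> 0" "q \<noteq> 0" for p q d :: real
      using that by simp
    then show ?thesis using m unfolding mult_2 power_add[of "m - 1" n n] by simp
  qed
  also have "\<dots> \<le> ?P n * ((m - 1) ^ (2 * n) / m ^ (2 * n + 1))"
    unfolding even_base by (rule mult_right_mono[OF step.IH]) (use m in simp)
  also have "\<dots> = ?P (Suc n)"
  proof -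
    obtain l where l: "n = Suc l" using step.hyps(1) by (cases n) auto
    have "real (2 * n) = m - 1" "real (2 * n + 1) = m" unfolding m_def by simp_all
    then have ratio: "(m - 1) ^ (2 * n) / m ^ (2 * n + 1)
        = real (2 * n) ^ (2 * n) / real (2 * n + 1) ^ (2 * n + 1)" by (simp only:)
    show ?thesis
      unfolding ratio unfolding l diff_Suc_1
      by (rule prod.nat_ivl_Suc'[THEN trans, OF _ mult.commute, symmetric]) simp
  qed
  finally show ?case unfolding m_def by (simp add: distrib_left)
qed

text \<open>For \<open>n = 2\<close> both sides are \<open>1\<close>. Otherwise the product is at
  least \<open>(2 * n) ^ n\<close> inverted, and the exponent \<open>1 / (2 * n)\<close> turns this
  into \<open>1 / sqrt (2 * n)\<close>.\<close>

lemma growth_const_ge: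
  assumes "n \<ge> 2"
  shows "growth_const n \<ge> sqrt (n / 2)"
proof (cases "n = 2")
  case True
  then show ?thesis by (simp add: growth_const_def)
next
  case False
  let ?P = "\<Prod>j = 1..n - 1. real (2 * j) ^ (2 * j) / real (2 * j + 1) ^ (2 * j + 1)"
  have "sqrt (n / 2) = n * (1 / (2 * real n)) powr (1 / 2)"
    using assms by (simp add: powr_half_sqrt real_sqrt_divide real_sqrt_mult field_simps)
  also have "(1 / (2 * real n)) powr (1 / 2) = ((1 / (2 * real n)) powr n) powr (1 / (2 * real n))"
    using assms by (simp add: powr_powr)
  also have "real n * \<dots> \<le> n * ?P powr (1 / (2 * real n))"
  proof (intro mult_left_mono powr_mono2)
    have "(1 / (2 * real n)) powr n \<le> 2 / (2 * real n) ^ n"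
      using assms by (simp add: powr_realpow power_divide divide_right_mono)
    also have "\<dots> \<le> ?P" using assms by (intro growth_const_product_ge) simp
    finally show "(1 / (2 * real n)) powr n \<le> ?P" .
  qed auto
  finally show ?thesis using False unfolding growth_const_def by simp
qed

section \<open>Blocks of full upper density\<close>

text \<open>The upper end \<open>i * fact i\<close> stops exactly \<open>fact i\<close> short of the
  next block, which begins at \<open>fact (Suc i)\<close>. The scaling by \<open>k\<close> reflects
  that one step of the orbit shifts coefficients by \<open>k\<close>.\<close>

definition factorial_blocks :: "bool \<Rightarrow> nat \<Rightarrow> nat set"
  where "factorial_blocks b k = {n. \<exists>i. even i = b \<and> fact i \<le> k * n \<and> k * n \<le> i * fact i}"

text \<open>If \<open>k * q = fact i\<close>, the block contains all of \<open>{q..i * q}\<close>,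
  hence a proportion of at least \<open>1 - 1 / i\<close> of the first \<open>i * q\<close> positive
  integers.\<close>

lemma upper_density_factorial_blocks:
  assumes "k \<ge> 1"
  shows "upper_density (factorial_blocks b k) = 1"
proof -
  let ?A = "factorial_blocks b k"
  define u where "u n = ereal (real (card (?A \<inter> {1..n})) / real n)" for n
  have le: "u n \<le> 1" for n
  proof -
    have "card (?A \<inter> {1..n}) \<le> n" using card_mono[of "{1..n}" "?A \<inter> {1..n}"] by simp
    then show ?thesis unfolding u_def one_ereal_def by (auto simp: divide_le_eq_1)
  qed
  \<comment> \<open>The required parity, and large enough for \<open>k\<close> to divide
    \<open>fact (i m)\<close>, so that the division in \<open>q\<close> is exact.\<close>
  define i where "i m = 2 * (m + k) + (if b then 0 else 1)" for m
  define q :: "nat \<Rightarrow> nat" where "q m = fact (i m) div k" for m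
  have q: "k * q m = fact (i m)" for m
    unfolding q_def by (rule dvd_mult_div_cancel, rule dvd_fact) (use assms in \<open>auto simp: i_def\<close>)
  have q_pos: "q m > 0" for m using q[of m] by (metis fact_nonzero mult_0_right neq0_conv)
  have mono: "strict_mono (\<lambda>m. i m * q m)"
  proof (rule strict_monoI_Suc)
    fix m
    have "fact (i m) \<le> (fact (i (Suc m)) :: nat)" by (rule fact_mono_nat) (simp add: i_def)
    then have "q m \<le> q (Suc m)" unfolding q_def by (rule div_le_mono)
    moreover have "i m < i (Suc m)" by (simp add: i_def)
    ultimately show "i m * q m < i (Suc m) * q (Suc m)"
      using q_pos[of m] by (meson dual_order.strict_trans2 mult_le_mono2 mult_less_mono1 q_pos)
  qed
  have ge: "ereal (1 - 1 / real (i m)) \<le> u (i m * q m)" for m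
  proof -
    have i: "i m \<ge> 1" using assms by (simp add: i_def)
    have "{q m..i m * q m} \<subseteq> ?A \<inter> {1..i m * q m}"
    proof
      fix n assume n: "n \<in> {q m..i m * q m}"
      then have "k * q m \<le> k * n" "k * n \<le> i m * (k * q m)" by auto
      then have "fact (i m) \<le> k * n" "k * n \<le> i m * fact (i m)" unfolding q by auto
      moreover have "even (i m) = b" by (simp add: i_def)
      ultimately show "n \<in> ?A \<inter> {1..i m * q m}"
        using n q_pos[of m] unfolding factorial_blocks_def by auto
    qed
    then have "card {q m..i m * q m} \<le> card (?A \<inter> {1..i m * q m})" by (intro card_mono) auto
    then have "real (i m * q m) - real (q m) \<le> card (?A \<inter> {1..i m * q m})"
      by (simp only: card_atLeastAtMost)
    then have "(real (i m * q m) - real (q m)) / real (i m * q m)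
        \<le> card (?A \<inter> {1..i m * q m}) / real (i m * q m)" by (intro divide_right_mono) auto
    moreover have "(real (i m * q m) - real (q m)) / real (i m * q m) = 1 - 1 / i m"
      using i q_pos[of m] by (simp add: field_simps)
    ultimately show ?thesis unfolding u_def by simp
  qed
  have "(\<lambda>m. 1 - 1 / real (i m)) \<longlonglongrightarrow> 1 - 0"
  proof (intro tendsto_intros tendsto_divide_0[OF tendsto_const] filterlim_at_top_imp_at_infinity
      filterlim_compose[OF filterlim_real_sequentially])
    show "filterlim i at_top sequentially"
      by (rule filterlim_at_top_mono[OF filterlim_ident]) (auto simp: i_def)
  qed
  then have "(\<lambda>m. ereal (1 - 1 / real (i m))) \<longlonglongrightarrow> 1" by (simp add: one_ereal_def)
  then have "1 = limsup (\<lambda>m. ereal (1 - 1 / real (i m)))"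
    using lim_imp_Limsup trivial_limit_sequentially by metis
  also have "\<dots> \<le> limsup (u \<circ> (\<lambda>m. i m * q m))" by (intro Limsup_mono) (simp add: ge)
  also have "\<dots> \<le> limsup u" by (rule limsup_subseq_mono[OF mono])
  finally have "1 \<le> limsup u" .
  moreover have "limsup u \<le> 1" by (rule Limsup_bounded) (simp add: le)
  ultimately show ?thesis unfolding upper_density_def u_def[symmetric] by (intro antisym)
qed

text \<open>Linear values make the orbit unbounded on the odd blocks and cost only a factor
  \<open>r\<close> over \<open>exp r\<close> in growth, which \<phi> absorbs.\<close>

definition block_coeff :: "nat \<Rightarrow> real"
  where "block_coeff j = (if \<exists>i. odd i \<and> fact i \<le> j \<and> j < fact (Suc i) then real j else 0)"

lemma block_coeff_bounds: "0 \<le> block_coeff j" "block_coeff j \<le> real j"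
  unfolding block_coeff_def by auto

lemma block_coeff_odd:
  assumes "n \<in> factorial_blocks False k"
  shows "block_coeff (k * n) = real (k * n)"
proof -
  obtain i where "odd i" "fact i \<le> k * n" "k * n \<le> i * fact i"
    using assms unfolding factorial_blocks_def by auto
  moreover then have "k * n < fact (Suc i)" using fact_gt_zero[of i, where 'a = nat]
    by (simp del: fact_gt_zero)
  ultimately show ?thesis unfolding block_coeff_def by metis
qed

text \<open>
  From an index in an even block the next nonzero coefficient is at least \<open>L = i!\<close> steps away, so
  that the polynomially bounded tail is paid for by the factor \<open>2 ^ j / 2 ^ L\<close>.
\<close>

lemma block_coeff_even_le:
  assumes "n \<in> factorial_blocks True k"
  shows "block_coeff (j + k * n) \<le> 2 / sqrt (k * n) * 8 ^ j"
proof (cases "block_coeff (j + k * n) = 0")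
  case False
  obtain i where i: "even i" "fact i \<le> k * n" "k * n \<le> i * fact i"
    using assms unfolding factorial_blocks_def by auto
  define L :: nat where "L = fact i"
  have L: "i \<le> L" "1 \<le> L" unfolding L_def by (simp_all add: fact_ge_self)
  obtain i' where i': "odd i'" "fact i' \<le> j + k * n" "j + k * n < fact (Suc i')"
    using False unfolding block_coeff_def by (auto split: if_splits)
  \<comment> \<open>Otherwise \<open>j + k * n\<close> would still lie in block \<open>i\<close>,
    forcing \<open>i' = i\<close> against parity.\<close>
  have "fact (Suc i) \<le> j + k * n"
  proof (rule ccontr)
    assume "\<not> ?thesis"
    then have "fact i' < (fact (Suc i) :: nat)" "fact i < (fact (Suc i') :: nat)"
      using i(2) i' by linarith+
    then have "i' < Suc i" "i < Suc i'" by (meson fact_mono_nat leD leI)+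
    then have "i = i'" by simp
    then show False using i(1) i'(1) by simp
  qed
  then have j: "L \<le> j" using i(3) unfolding L_def by simp
  have "block_coeff (j + k * n) \<le> real (j + k * n)" by (rule block_coeff_bounds)
  \<comment> \<open>Since \<open>k * n \<le> i * L \<le> L * L \<le> j * j\<close>, the offset
    \<open>j\<close> alone controls the whole index.\<close>
  also have "j + k * n \<le> j * j + j * j"
    using i(3) j L mult_le_mono[of i j L j] unfolding L_def[symmetric] by (intro add_mono) auto
  also have "real (j * j + j * j) \<le> 2 * 4 ^ j"
  proof -
    have "real j \<le> 2 ^ j" using of_nat_less_two_power[of j, where 'a = real] by simp
    then have "real j * real j \<le> 2 ^ j * 2 ^ j" by (intro mult_mono) auto
    then show ?thesis by (simp flip: power_mult_distrib)
  qed
  also have "\<dots> \<le> 2 * 4 ^ j * (2 ^ j / 2 ^ L)"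
    using j by (intro mult_le_cancel_left1[THEN iffD2]) (simp add: power_increasing)
  also have "\<dots> = 2 / 2 ^ L * 8 ^ j" by (simp flip: power_mult_distrib)
  also have "\<dots> \<le> 2 / sqrt (k * n) * 8 ^ j"
  proof -
    have "0 < k * n" using i(2) fact_gt_zero[of i, where 'a = nat] by linarith
    moreover have "sqrt (k * n) \<le> 2 ^ L"
    proof -
      have "k * n \<le> L * L" using i(3) L mult_le_mono1[of i L L] unfolding L_def by linarith
      then have "real (k * n) \<le> (real L)\<^sup>2" by (metis of_nat_le_iff of_nat_mult power2_eq_square)
      then have "sqrt (k * n) \<le> L" by (intro real_le_lsqrt) auto
      also have "real L \<le> 2 ^ L" using of_nat_less_two_power[of L, where 'a = real] by simp
      finally show ?thesis .
    qed
    ultimately show ?thesis by (intro mult_right_mono divide_left_mono) auto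
  qed
  finally show ?thesis by simp
qed simp

section \<open>The irregular function\<close>

lemma sums_linear_exp: "(\<lambda>n. real n / fact n * r ^ n) sums (r * exp r)"
proof -
  have "(\<lambda>n. r * (r ^ n /\<^sub>R fact n)) sums (r * exp r)" by (rule sums_mult[OF exp_converges])
  moreover have "r * (r ^ n /\<^sub>R fact n) = real (Suc n) / fact (Suc n) * r ^ Suc n" for n
    by (simp add: field_simps del: of_nat_Suc)
  ultimately show ?thesis
    using sums_Suc[of "\<lambda>n. real n / fact n * r ^ n" "r * exp r"] by (simp only:) simp
qed

lemma egf_entire_block_coeff: "egf_entire (\<lambda>j. of_real (block_coeff j))"
proof (rule egf_entire_exp_type)
  show "norm (complex_of_real (block_coeff n)) \<le> 1 * 2 ^ n" for n
    using block_coeff_bounds[of n] less_imp_le[OF of_nat_less_two_power[of n, where 'a = real]]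
    by (simp add: order_trans)
qed

text \<open>All terms are nonnegative, so the sum dominates its constant term. For the shifted
  coefficients of the orbit that term is \<open>block_coeff (k * n)\<close>.\<close>

lemma egf_nonneg_ge:
  assumes "egf_entire (\<lambda>j. of_real (b j))" "\<And>j. b j \<ge> 0" "\<rho> \<ge> 0"
  shows "Re (egf (\<lambda>j. of_real (b j)) (of_real \<rho>)) \<ge> b 0"
proof -
  let ?t = "\<lambda>n. complex_of_real (b n) / fact n * of_real \<rho> ^ n"
  have t: "Re (?t n) = b n / fact n * \<rho> ^ n" for n
    by (metis (no_types, lifting) Re_complex_of_real of_real_divide of_real_fact of_real_mult of_real_power)
  have s: "summable ?t" using assms(1) unfolding egf_entire_def by blast
  have "(\<Sum>n\<in>{0}. Re (?t n)) \<le> (\<Sum>n. Re (?t n))"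
  proof (rule sum_le_suminf[OF summable_Re[OF s]])
    show "0 \<le> Re (?t n)" for n unfolding t using assms(2,3) by simp
  qed simp
  then show ?thesis unfolding egf_def Re_suminf[OF s] by simp
qed

theorem theorem5p1:
  fixes \<alpha> :: "nat ^ 'n::{finite,linorder}"
    and \<phi> :: "real \<Rightarrow> real"
  assumes "CARD('n) \<ge> 2"
    and "\<alpha> \<noteq> 0"
    and "\<phi> \<in> {0..} \<rightarrow> {0..}"
    and "\<And>p::real. p \<ge> 0 \<Longrightarrow> filterlim (\<lambda>r. \<phi> r / r powr p) at_top at_top"
  shows "\<exists>h \<in> harmonic_space.
      distributionally_irregular harmonic_space harmonic_seminorm (multi_deriv \<alpha>) h \<and>
      (\<forall>\<^sub>F r in at_top. M_infty h r \<le> \<phi> r * exp (growth_const CARD('n) * r))"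
proof -
  define k where "k = (\<Sum>i\<in>UNIV. \<alpha> $ i)"
  have k: "k \<ge> 1" using assms(2) unfolding k_def by (auto simp: vec_eq_iff Suc_le_eq sum_eq_0_iff intro!: gr0I)
  then obtain \<zeta> :: "'n \<Rightarrow> complex" where \<zeta>: "\<And>i. norm (\<zeta> i) = 1" "(\<Sum>i\<in>UNIV. (\<zeta> i)\<^sup>2) = 0"
    and one: "(\<Prod>i\<in>UNIV. \<zeta> i ^ (\<alpha> $ i)) = 1"
    using exists_unimodular_exponents[OF assms(1), of "\<lambda>i. \<alpha> $ i"] unfolding k_def by auto
  define c where "c = sqrt (CARD('n) / 2)"
  have c: "c \<ge> 0" "c \<le> growth_const CARD('n)"
    using growth_const_ge[OF assms(1)] unfolding c_def by auto
  note lin_form_le = norm_lin_form_le[OF \<zeta>, folded c_def]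
  define b where "b n = (\<lambda>j. complex_of_real (block_coeff (j + k * n)))" for n
  have entire: "egf_entire (b n)" for n
    unfolding b_def by (rule egf_entire_shift[OF egf_entire_block_coeff])
  define h where "h = wave \<zeta> (b 0)"
  have orbit: "(multi_deriv \<alpha> ^^ n) h = wave \<zeta> (b n)" for n
    using multi_deriv_pow_wave[OF entire[of 0] one, of n] unfolding h_def b_def k_def by simp
  have harmonic: "wave \<zeta> (b n) \<in> harmonic_space" for n
    by (rule wave_harmonic[OF entire \<zeta>(2)])
  have "limitin (seminorm_topology harmonic_space harmonic_seminorm) (\<lambda>n. wave \<zeta> (b n)) 0
      (inf sequentially (principal (factorial_blocks True k)))"
  proof (rule limitin_harmonic_zero[OF harmonic])
    fix r :: real assume r: "r > 0"
    \<comment> \<open>The base \<open>8\<close> of the coefficient bound becomes the exponential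
      type; the prefactor tends to \<open>0\<close> while \<open>r\<close> is fixed.\<close>
    let ?S = "\<lambda>n. 2 / sqrt (k * n) * exp (8 * (c * r))"
    have upper: "M_infty (wave \<zeta> (b n)) r \<le> ?S n" if n: "n \<in> factorial_blocks True k" for n
    proof (rule M_infty_le)
      fix x :: "real ^ 'n::{finite,linorder}" assume "norm x = r"
      then have x: "norm (lin_form \<zeta> x) \<le> c * r" using lin_form_le[of x] by simp
      have "\<bar>wave \<zeta> (b n) x\<bar> \<le> norm (egf (b n) (lin_form \<zeta> x))"
        unfolding wave_def by (rule abs_Re_le_cmod)
      also have "\<dots> \<le> 2 / sqrt (k * n) * exp (8 * norm (lin_form \<zeta> x))"
        by (rule norm_egf_le[OF _ exp_type_sums])
          (use block_coeff_even_le[OF n] block_coeff_bounds in \<open>simp add: b_def\<close>)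
      also have "\<dots> \<le> ?S n" using x by (intro mult_left_mono) auto
      finally show "\<bar>wave \<zeta> (b n) x\<bar> \<le> ?S n" .
    qed (use r in simp)
    have "filterlim (\<lambda>n. sqrt (real k * real n)) at_top sequentially"
      by (intro filterlim_compose[OF sqrt_at_top]
          filterlim_tendsto_pos_mult_at_top[OF tendsto_const _ filterlim_real_sequentially]) (use k in simp)
    then have "?S \<longlonglongrightarrow> 0 * exp (8 * (c * r))"
      by (intro tendsto_intros tendsto_divide_0[OF tendsto_const] filterlim_at_top_imp_at_infinity) simp
    then have lim: "(?S \<longlongrightarrow> 0) (inf sequentially (principal (factorial_blocks True k)))"
      by (intro tendsto_mono[OF inf_le1]) simp
    show "((\<lambda>n. M_infty (wave \<zeta> (b n)) r) \<longlongrightarrow> 0) (inf sequentially (principal (factorial_blocks True k)))"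
    proof (rule tendsto_sandwich[OF _ _ tendsto_const lim])
      show "\<forall>\<^sub>F n in inf sequentially (principal (factorial_blocks True k)).
          0 \<le> M_infty (wave \<zeta> (b n)) r"
        using r by (intro always_eventually allI M_infty_nonneg continuous_on_wave entire) simp
      show "\<forall>\<^sub>F n in inf sequentially (principal (factorial_blocks True k)).
          M_infty (wave \<zeta> (b n)) r \<le> ?S n"
        unfolding eventually_inf_principal using upper by (intro always_eventually) blast
    qed
  qed
  moreover have "filterlim (\<lambda>n. harmonic_seminorm 1 (wave \<zeta> (b n))) at_top
      (inf sequentially (principal (factorial_blocks False k)))"
  proof -
    \<comment> \<open>A single unit vector serves for all \<open>n\<close>, so the seminorm of index
      \<open>1\<close> detects the growth.\<close>
    obtain x \<rho> where x: "norm x = 1" "\<rho> \<ge> 0" "lin_form \<zeta> x = complex_of_real \<rho>"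
      using lin_form_eq_of_real[OF \<zeta>] .
    have lower: "real n \<le> harmonic_seminorm 1 (wave \<zeta> (b n))" if n: "n \<in> factorial_blocks False k" for n
    proof -
      have "real n \<le> block_coeff (0 + k * n)"
        using k unfolding add_0 block_coeff_odd[OF n] of_nat_le_iff by simp
      also have "\<dots> \<le> Re (egf (b n) (of_real \<rho>))"
        using egf_nonneg_ge[OF entire[of n, unfolded b_def] _ x(2)] block_coeff_bounds(1) unfolding b_def by blast
      also have "\<dots> \<le> \<bar>wave \<zeta> (b n) x\<bar>" unfolding wave_def x(3) by (rule abs_ge_self)
      also have "\<dots> \<le> harmonic_seminorm 1 (wave \<zeta> (b n))"
        unfolding harmonic_seminorm_def by (rule M_infty_ge[OF continuous_on_wave[OF entire]]) (simp add: x)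
      finally show ?thesis .
    qed
    have "filterlim real at_top (inf sequentially (principal (factorial_blocks False k)))"
      by (rule filterlim_mono[OF filterlim_real_sequentially order_refl inf_le1])
    then show ?thesis
      by (rule filterlim_at_top_mono)
        (unfold eventually_inf_principal, use lower in \<open>intro always_eventually, blast\<close>)
  qed
  ultimately have "distributionally_irregular harmonic_space harmonic_seminorm (multi_deriv \<alpha>) h"
    unfolding distributionally_irregular_def orbit
    using upper_density_factorial_blocks[OF k] harmonic[of 0] unfolding h_def by blast
  moreover have "\<forall>\<^sub>F r in at_top. M_infty h r \<le> \<phi> r * exp (growth_const CARD('n) * r)"
  proof -
    \<comment> \<open>The case \<open>p = 1\<close> suffices: it yields
      \<open>c * r \<le> \<phi> r\<close>, which covers the linear factor of the growth
      bound.\<close>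
    have "\<forall>\<^sub>F r in at_top. c \<le> \<phi> r / r powr 1"
      using assms(4)[of 1] unfolding filterlim_at_top by simp
    then show ?thesis using eventually_gt_at_top[of 0]
    proof eventually_elim
      case (elim r)
      show ?case
      proof (rule M_infty_le)
        fix x :: "real ^ 'n::{finite,linorder}" assume "norm x = r"
        then have x: "norm (lin_form \<zeta> x) \<le> c * r" using lin_form_le[of x] by simp
        have "\<bar>h x\<bar> \<le> norm (egf (b 0) (lin_form \<zeta> x))"
          unfolding h_def wave_def by (rule abs_Re_le_cmod)
        also have "\<dots> \<le> norm (lin_form \<zeta> x) * exp (norm (lin_form \<zeta> x))"
          by (rule norm_egf_le[OF _ sums_linear_exp]) (use block_coeff_bounds in \<open>simp add: b_def\<close>)
        also have "\<dots> \<le> (c * r) * exp (growth_const CARD('n) * r)"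
          using x c elim(2) order_trans[OF x mult_right_mono[OF c(2)]] by (intro mult_mono) auto
        also have "\<dots> \<le> \<phi> r * exp (growth_const CARD('n) * r)"
          using elim by (intro mult_right_mono) (auto simp: pos_le_divide_eq)
        finally show "\<bar>h x\<bar> \<le> \<phi> r * exp (growth_const CARD('n) * r)" .
      qed (use elim in simp)
    qed
  qed
  ultimately show ?thesis using harmonic[of 0] unfolding h_def by blast
qed

end
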